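(* Fix $x\in\mathcal{D}$, and consider the two-phase setting, the consistent one-step scheme (consistency orders $p>1$ in the value and $q>1$ in the right-hand side), and the single-step evolution error $e^\ell(m,x)$ described in the context. Suppose that all grid points of the stencil $\boldsymbol{U}_m(x)$ lie in $\Omega_1$ and that $\tau_m<\gamma(x)<\tau_{m+1}$. Let $$\partial_t^+u(x,\gamma(x)):=\lim_{h\to0^+}\frac{u(x,\gamma(x)+h)-u(x,\gamma(x))}{h},\qquad \partial_t^-u(x,\gamma(x)):=\lim_{h\to0^-}\frac{u(x,\gamma(x)+h)-u(x,\gamma(x))}{h}.$$ Then $$e^\ell(m,x)=\bigl(\partial_t^+u(x,\gamma(x))-\partial_t^-u(x,\gamma(x))\bigr)\,\mathcal{O}(\Delta t)+\mathcal{O}(\Delta x^p)\qquad\text{as }\Delta t,\Delta x\to0.$$ That is, there are constants $C,\delta_0>0$, independent of $\Delta t$, $\Delta x$ and $m$ (but possibly depending on $x$, $u$ and the scheme), such that whenever $0<\Delta t,\Delta x<\delta_0$ and the two suppositions above hold, one can write $e^\ell(m,x)=\bigl(\partial_t^+u(x,\gamma(x))-\partial_t^-u(x,\gamma(x))\bigr)R_1+R_2$ with $|R_1|\le C\Delta t$ and $|R_2|\le C\Delta x^p$.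
   Context: Two-phase setting. Let $\mathcal{D}=[x_{\min},x_{\max}]$ with $x_{\min}<x_{\max}$, let $T>0$, and let $\Omega=\mathcal{D}\times[0,T]$. For some $\varepsilon>0$, let $\gamma:\mathcal{D}\to(\varepsilon,T-\varepsilon)$ be continuous. Its graph $\Gamma=\{(x,\gamma(x)):x\in\mathcal{D}\}$ (the phase boundary) separates $\Omega$ into two disjoint open connected subsets $\Omega_1$ (the part $t<\gamma(x)$, whose closure contains $\mathcal{D}\times\{0\}$) and $\Omega_2$ (the part $t>\gamma(x)$, whose closure contains $\mathcal{D}\times\{T\}$), with $\overline{\Omega}_1\cup\overline{\Omega}_2=\Omega$ and $\Gamma=\partial\Omega_1\cap\partial\Omega_2$. The function $u:\Omega\to\mathbb{R}$ is continuous on $\Omega$. Its restrictions to $\Omega_1$ and $\Omega_2$ are at least $P$ times differentiable in the spatial variable, for some integer $P\ge0$. In each of $\Omega_1$ and $\Omega_2$ it satisfies an evolution PDE of the form $\partial_tu=$ (linear combination of monomials in spatial partial derivatives of $u$ of order at most $P$), possibly with different coefficients in the two regions. Within each phase $u$ is smooth in time up to the phase boundary, so that Taylor expansion is available: for each $x\in\mathcal{D}$, the map $t\mapsto u(x,t)$ is twice continuously differentiable on $[0,\gamma(x)]$ and on $[\gamma(x),T]$ (one-sided derivatives at $\gamma(x)$, which may differ). No smoothness across $t=\gamma(x)$ is assumed. Right-hand side. $\mathcal{F}_\ell(x,t)$ denotes the right-hand side of the PDE governing $\Omega_1$, so that $u_t(x,t)=\mathcal{F}_\ell(x,t)$ for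 $(x,t)\in\Omega_1$. Grid and data. Let $\Delta x,\Delta t>0$ be the spatial and temporal grid spacings. For a spatial point $x$, let $\tau_m=\tau_m(x)=\gamma^\ell(x)+(m-1)\Delta t$, $m=0,1,\dots,M_x$, be uniform time grid points, where $\gamma^\ell,\gamma^r:\mathcal{D}\to(0,T)$ satisfy $\gamma^\ell<\gamma^r$ and $M_x=(\gamma^r(x)-\gamma^\ell(x))/\Delta t$; thus $\tau_{m+1}-\tau_m=\Delta t$. The data are taken to be exact: $U_m(y)=u(y,\tau_m)$. For a fixed integer $h\ge1$ (the stencil half-width), set $\boldsymbol{U}_m(x)=(U_m(x-h\Delta x),\dots,U_m(x+h\Delta x))\in\mathbb{R}^{2h+1}$, with periodic boundary conditions in space. The notation $\boldsymbol{U}_m(x)\subseteq\Omega_1$ means that all the grid points $(x+j\Delta x,\tau_m)$, $j=-h,\dots,h$, lie in $\Omega_1$. Scheme. $\widehat{U}_m(x)$ is an approximation of $u(x,\tau_m)$ given by a linear combination of the entries of $\boldsymbol{U}_m(x)$, and $\widehat{\mathcal{F}}_\ell(\boldsymbol{U}_m(x))$ is a discretization of $\mathcal{F}_\ell(x,\tau_m)$. The one-step numerical evolution is $$\widetilde{U}^\ell_{m+1}(x)=\widehat{U}_m(x)+\Delta t\,\widehat{\mathcal{F}}_\ell(\boldsymbol{U}_m(x)),$$ and the single-step evolution error is $e^\ell(m,x)=\bigl|\widetilde{U}^\ell_{m+1}(x)-U_{m+1}(x)\bigr|$. Consistency assumption. There are $p>1$ and $q>1$ such that, whenever $(x,\tau_m)\in\Omega_1$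 and $\boldsymbol{U}_m(x)\subseteq\Omega_1$, $$u(x,\tau_m)=\widehat{U}_m(x)+\mathcal{O}(\Delta x^p),\qquad \mathcal{F}_\ell(x,\tau_m)=\widehat{\mathcal{F}}_\ell(\boldsymbol{U}_m(x))+\mathcal{O}(\Delta x^q),$$ with implied constants independent of $\Delta t$, $\Delta x$ and $m$.
   Formalization: If the one-sided time derivatives of u at (x,γ(x)) are equal, the claimed bound |R_2| ≤ CΔx^p is false (e.g. u=e^t, u_t=u, exact scheme); in that case only, the bound proved is |R_2| ≤ C(Δx^p+Δt²+ΔtΔx^q). *)

theory Defs
  imports "HOL-Analysis.Analysis"
begin

section \<open>The two phases\<close>

definition Omega :: "real \<Rightarrow> real \<Rightarrow> real \<Rightarrow> (real \<times> real) set" where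
  "Omega xmin xmax T = {xmin..xmax} \<times> {0..T}"

text \<open>
  The phases are the parts of \<^term>\<open>Omega xmin xmax T\<close> strictly below and strictly above the graph
  of \<open>\<gamma>\<close>. They are open relative to the rectangle; in particular \<open>Omega1\<close> contains the initial
  line and \<open>Omega2\<close> the final one.
\<close>

definition Omega1 :: "real \<Rightarrow> real \<Rightarrow> real \<Rightarrow> (real \<Rightarrow> real) \<Rightarrow> (real \<times> real) set" where
  "Omega1 xmin xmax T \<gamma> = {(x, t) \<in> Omega xmin xmax T. t < \<gamma> x}"

definition Omega2 :: "real \<Rightarrow> real \<Rightarrow> real \<Rightarrow> (real \<Rightarrow> real) \<Rightarrow> (real \<times> real) set" where
  "Omega2 xmin xmax T \<gamma> = {(x, t) \<in> Omega xmin xmax T. t > \<gamma> x}"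


section \<open>Derivatives and the evolution equations\<close>

text \<open>
  The \<open>k\<close>-th spatial derivative of \<open>u\<close> restricted to a region \<open>R\<close>. Derivatives are taken within the
  slice of \<open>R\<close> at time \<open>t\<close>, so that they are one-sided at the two ends of the spatial interval. The
  slices of the two phases have no isolated points, hence these derivatives are unique.
\<close>

primrec spatial_deriv ::
    "(real \<times> real) set \<Rightarrow> (real \<Rightarrow> real \<Rightarrow> real) \<Rightarrow> nat \<Rightarrow> real \<Rightarrow> real \<Rightarrow> real" where
  "spatial_deriv R u 0 x t = u x t"
| "spatial_deriv R u (Suc k) x t =
     vector_derivative (\<lambda>y. spatial_deriv R u k y t) (at x within {y. (y, t) \<in> R})"

definition spatially_differentiable ::
    "nat \<Rightarrow> (real \<times> real) set \<Rightarrow> (real \<Rightarrow> real \<Rightarrow> real) \<Rightarrow> bool" where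
  "spatially_differentiable P R u \<longleftrightarrow>
     (\<forall>k<P. \<forall>(x, t)\<in>R.
        (\<lambda>y. spatial_deriv R u k y t) differentiable (at x within {y. (y, t) \<in> R}))"

text \<open>
  A linear combination, with coefficients \<open>c\<close>, of the monomials \<open>\<Prod>k\<le>P. (\<partial>\<^sub>x\<^sup>k u)\<^bsup>\<alpha> k\<^esup>\<close> with exponent
  vectors \<open>\<alpha>\<close> ranging over the finite set \<open>A\<close>.
\<close>

definition pde_rhs ::
    "nat \<Rightarrow> (nat \<Rightarrow> nat) set \<Rightarrow> ((nat \<Rightarrow> nat) \<Rightarrow> real) \<Rightarrow> (real \<times> real) set
      \<Rightarrow> (real \<Rightarrow> real \<Rightarrow> real) \<Rightarrow> real \<Rightarrow> real \<Rightarrow> real" where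
  "pde_rhs P A c R u x t = (\<Sum>\<alpha>\<in>A. c \<alpha> * (\<Prod>k\<le>P. spatial_deriv R u k x t ^ \<alpha> k))"

definition satisfies_pde ::
    "real \<Rightarrow> (real \<times> real) set \<Rightarrow> (real \<Rightarrow> real \<Rightarrow> real) \<Rightarrow> (real \<Rightarrow> real \<Rightarrow> real) \<Rightarrow> bool" where
  "satisfies_pde T R u F \<longleftrightarrow>
     (\<forall>(x, t)\<in>R. ((\<lambda>s. u x s) has_real_derivative F x t) (at t within {0..T}))"

definition C2_on :: "(real \<Rightarrow> real) \<Rightarrow> real set \<Rightarrow> bool" where
  "C2_on f S \<longleftrightarrow>
     (\<exists>f' f''. (\<forall>t\<in>S. (f has_real_derivative f' t) (at t within S)) \<and>
               (\<forall>t\<in>S. (f' has_real_derivative f'' t) (at t within S)) \<and>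
               continuous_on S f'')"

definition dt_plus :: "(real \<Rightarrow> real \<Rightarrow> real) \<Rightarrow> real \<Rightarrow> real \<Rightarrow> real" where
  "dt_plus u x s = Lim (at_right 0) (\<lambda>h. (u x (s + h) - u x s) / h)"

definition dt_minus :: "(real \<Rightarrow> real \<Rightarrow> real) \<Rightarrow> real \<Rightarrow> real \<Rightarrow> real" where
  "dt_minus u x s = Lim (at_left 0) (\<lambda>h. (u x (s + h) - u x s) / h)"


section \<open>Grid, stencils and the one-step scheme\<close>

definition tau :: "(real \<Rightarrow> real) \<Rightarrow> real \<Rightarrow> real \<Rightarrow> nat \<Rightarrow> real" where
  "tau \<gamma>l x \<Delta>t m = \<gamma>l x + (real m - 1) * \<Delta>t"

text \<open>\<open>m\<close> is one of \<open>0, \<dots>, M\<^sub>x\<close>, where \<open>M\<^sub>x = (\<gamma>r x - \<gamma>l x) / \<Delta>t\<close> has to be a natural number.\<close>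

definition grid_index ::
    "(real \<Rightarrow> real) \<Rightarrow> (real \<Rightarrow> real) \<Rightarrow> real \<Rightarrow> real \<Rightarrow> nat \<Rightarrow> bool" where
  "grid_index \<gamma>l \<gamma>r x \<Delta>t m \<longleftrightarrow> (\<exists>M::nat. real M = (\<gamma>r x - \<gamma>l x) / \<Delta>t \<and> m \<le> M)"

text \<open>
  Periodic boundary conditions: a point outside the interval is shifted into it by a multiple of the
  period \<open>xmax - xmin\<close>. Points of the closed interval, both ends included, are left unchanged.
\<close>

definition wrap :: "real \<Rightarrow> real \<Rightarrow> real \<Rightarrow> real" where
  "wrap xmin xmax y =
     (if y \<in> {xmin..xmax} then y
      else xmin + (xmax - xmin) * frac ((y - xmin) / (xmax - xmin)))"

definition stencil_point ::
    "real \<Rightarrow> real \<Rightarrow> real \<Rightarrow> real \<Rightarrow> int \<Rightarrow> real" where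
  "stencil_point xmin xmax x \<Delta>x j = wrap xmin xmax (x + of_int j * \<Delta>x)"

text \<open>
  The vector of the \<open>2h + 1\<close> data values around \<open>x\<close> at time \<open>t\<close>, indexed by \<open>-h, \<dots>, h\<close>. The
  restriction to this index range makes every function of the vector depend on these entries only.
\<close>

definition stencil ::
    "real \<Rightarrow> real \<Rightarrow> (real \<Rightarrow> real \<Rightarrow> real) \<Rightarrow> nat \<Rightarrow> real \<Rightarrow> real \<Rightarrow> real \<Rightarrow> (int \<Rightarrow> real)" where
  "stencil xmin xmax u h \<Delta>x x t =
     (\<lambda>j\<in>{- int h..int h}. u (stencil_point xmin xmax x \<Delta>x j) t)"

definition stencil_within ::
    "real \<Rightarrow> real \<Rightarrow> nat \<Rightarrow> real \<Rightarrow> real \<Rightarrow> real \<Rightarrow> (real \<times> real) set \<Rightarrow> bool" where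
  "stencil_within xmin xmax h \<Delta>x x t R \<longleftrightarrow>
     (\<forall>j\<in>{- int h..int h}. (stencil_point xmin xmax x \<Delta>x j, t) \<in> R)"

text \<open>
  The weights \<open>w\<close> and the discrete right-hand side \<open>Fhat\<close> below are those of the scheme for given
  grid spacings \<open>\<Delta>t\<close>, \<open>\<Delta>x\<close>.
\<close>

definition Uhat :: "nat \<Rightarrow> (int \<Rightarrow> real) \<Rightarrow> (int \<Rightarrow> real) \<Rightarrow> real" where
  "Uhat h w U = (\<Sum>j\<in>{- int h..int h}. w j * U j)"

definition one_step ::
    "nat \<Rightarrow> (int \<Rightarrow> real) \<Rightarrow> ((int \<Rightarrow> real) \<Rightarrow> real) \<Rightarrow> real \<Rightarrow> (int \<Rightarrow> real) \<Rightarrow> real" where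
  "one_step h w Fhat \<Delta>t U = Uhat h w U + \<Delta>t * Fhat U"

definition evolution_error ::
    "real \<Rightarrow> real \<Rightarrow> (real \<Rightarrow> real \<Rightarrow> real) \<Rightarrow> (real \<Rightarrow> real) \<Rightarrow> nat \<Rightarrow> (int \<Rightarrow> real)
      \<Rightarrow> ((int \<Rightarrow> real) \<Rightarrow> real) \<Rightarrow> real \<Rightarrow> real \<Rightarrow> nat \<Rightarrow> real \<Rightarrow> real" where
  "evolution_error xmin xmax u \<gamma>l h w Fhat \<Delta>t \<Delta>x m x =
     \<bar>one_step h w Fhat \<Delta>t (stencil xmin xmax u h \<Delta>x x (tau \<gamma>l x \<Delta>t m))
       - u x (tau \<gamma>l x \<Delta>t (Suc m))\<bar>"

text \<open>
  Consistency at the spatial point \<open>x\<close> in the region \<open>R\<close>, of order \<open>p\<close> in the value and of order \<open>q\<close>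
  in the right-hand side \<open>F\<close>.
\<close>

definition consistent ::
    "real \<Rightarrow> real \<Rightarrow> (real \<times> real) set \<Rightarrow> (real \<Rightarrow> real \<Rightarrow> real) \<Rightarrow> (real \<Rightarrow> real \<Rightarrow> real)
      \<Rightarrow> (real \<Rightarrow> real) \<Rightarrow> (real \<Rightarrow> real) \<Rightarrow> nat \<Rightarrow> (real \<Rightarrow> real \<Rightarrow> int \<Rightarrow> real)
      \<Rightarrow> (real \<Rightarrow> real \<Rightarrow> (int \<Rightarrow> real) \<Rightarrow> real) \<Rightarrow> real \<Rightarrow> real \<Rightarrow> real \<Rightarrow> bool" where
  "consistent xmin xmax R u F \<gamma>l \<gamma>r h w Fhat p q x \<longleftrightarrow>
     (\<exists>K>0. \<exists>\<delta>>0. \<forall>\<Delta>t \<Delta>x m.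
        0 < \<Delta>t \<longrightarrow> \<Delta>t < \<delta> \<longrightarrow> 0 < \<Delta>x \<longrightarrow> \<Delta>x < \<delta> \<longrightarrow> grid_index \<gamma>l \<gamma>r x \<Delta>t m \<longrightarrow>
        (x, tau \<gamma>l x \<Delta>t m) \<in> R \<longrightarrow>
        stencil_within xmin xmax h \<Delta>x x (tau \<gamma>l x \<Delta>t m) R \<longrightarrow>
          \<bar>u x (tau \<gamma>l x \<Delta>t m)
            - Uhat h (w \<Delta>t \<Delta>x) (stencil xmin xmax u h \<Delta>x x (tau \<gamma>l x \<Delta>t m))\<bar> \<le> K * \<Delta>x powr p \<and>
          \<bar>F x (tau \<gamma>l x \<Delta>t m)
            - Fhat \<Delta>t \<Delta>x (stencil xmin xmax u h \<Delta>x x (tau \<gamma>l x \<Delta>t m))\<bar> \<le> K * \<Delta>x powr q)"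

text \<open>
  If \<open>\<partial>\<^sub>t\<^sup>+u = \<partial>\<^sub>t\<^sup>-u\<close> at the phase boundary, no bound \<open>C * \<Delta>x powr p\<close> on the evolution error can
  hold for unrelated spacings: for \<open>u x t = exp t\<close>, which solves \<open>u\<^sub>t = u\<close>, and the exact data
  \<open>Uhat = Fhat = u\<close>, the error is \<open>exp (\<tau>\<^sub>m) * (exp \<Delta>t - 1 - \<Delta>t)\<close>, whatever \<open>\<Delta>x\<close> is. The error
  estimate therefore carries, in that case only, the local truncation error
  \<open>\<Delta>t\<^sup>2 + \<Delta>t * \<Delta>x powr q\<close> of a step that does not cross a kink. If the one-sided derivatives differ,
  these terms are absorbed by the multiple of their difference.
\<close>

end

theory Submission
  imports Defs
begin

text \<open>
  Expanding \<open>u x\<close> on either side of the phase boundary about \<open>\<gamma> x\<close> gives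
  \<open>u(\<tau>\<^sub>m) + \<Delta>t u\<^sub>t(\<tau>\<^sub>m) - u(\<tau>\<^sub>m\<^sub>+\<^sub>1) = - (\<tau>\<^sub>m\<^sub>+\<^sub>1 - \<gamma> x) (\<partial>\<^sub>t\<^sup>+u - \<partial>\<^sub>t\<^sup>-u) + O(\<Delta>t\<^sup>2)\<close>.
  The consistency error of \<open>Uhat\<close> contributes \<open>O(\<Delta>x powr p)\<close>; every other term carries a factor
  \<open>\<Delta>t\<close>, so that it is a multiple of the jump whenever the jump does not vanish.
\<close>

text \<open>Both bounds come from the mean value inequality, applied first to \<open>f'\<close> and
  then to the Taylor remainder, whose derivative is \<open>f' r - f' s\<close>. A bound for
  \<open>f''\<close> on the compact interval thus serves as the single \<open>K\<close>; the factor
  1/2 is given up. The two points may come in either order, so expansion backwards in time from the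
  phase boundary is included.\<close>

lemma C2_on_Taylor_bound:
  fixes f :: "real \<Rightarrow> real"
  assumes "C2_on f {a..b}"
  obtains f' K where "K \<ge> 0"
    and "\<And>t. t \<in> {a..b} \<Longrightarrow> (f has_real_derivative f' t) (at t within {a..b})"
    and "\<And>s t. s \<in> {a..b} \<Longrightarrow> t \<in> {a..b} \<Longrightarrow> \<bar>f' t - f' s\<bar> \<le> K * \<bar>t - s\<bar>"
    and "\<And>s t. s \<in> {a..b} \<Longrightarrow> t \<in> {a..b} \<Longrightarrow> \<bar>f t - f s - (t - s) * f' s\<bar> \<le> K * (t - s)\<^sup>2"
proof -
  obtain f' f'' where f': "\<And>t. t \<in> {a..b} \<Longrightarrow> (f has_real_derivative f' t) (at t within {a..b})"
    and f'': "\<And>t. t \<in> {a..b} \<Longrightarrow> (f' has_real_derivative f'' t) (at t within {a..b})"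
    and cont: "continuous_on {a..b} f''"
    using assms unfolding C2_on_def by blast
  have "bounded (f'' ` {a..b})"
    using cont by (intro compact_imp_bounded compact_continuous_image) auto
  then obtain K where K: "K > 0" "\<And>t. t \<in> {a..b} \<Longrightarrow> \<bar>f'' t\<bar> \<le> K"
    unfolding bounded_pos by auto
  have lip: "\<bar>f' t - f' s\<bar> \<le> K * \<bar>t - s\<bar>" if "s \<in> {a..b}" "t \<in> {a..b}" for s t
    using field_differentiable_bound[of "{a..b}" f' f'' K t s] f'' K that by auto
  have "\<bar>f t - f s - (t - s) * f' s\<bar> \<le> K * (t - s)\<^sup>2" if st: "s \<in> {a..b}" "t \<in> {a..b}" for s t
  proof -
    \<comment> \<open>On this segment, unlike on all of \<open>{a..b}\<close>, the derivative of the
      remainder is at most \<open>K * \<bar>t - s\<bar>\<close>, which makes the final bound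
      quadratic.\<close>
    let ?S = "closed_segment s t"
    let ?g = "\<lambda>r. f r - f s - (r - s) * f' s"
    have sub: "?S \<subseteq> {a..b}"
      using st by (intro closed_segment_subset) auto
    have deriv: "(?g has_real_derivative f' r - f' s) (at r within ?S)" if "r \<in> ?S" for r
    proof -
      have "(f has_real_derivative f' r) (at r within ?S)"
        using f' sub that by (blast intro: DERIV_subset)
      then show ?thesis
        by (auto intro!: derivative_eq_intros)
    qed
    have "\<bar>f' r - f' s\<bar> \<le> K * \<bar>t - s\<bar>" if "r \<in> ?S" for r
    proof -
      have "\<bar>r - s\<bar> \<le> \<bar>t - s\<bar>"
        using that by (auto simp: closed_segment_eq_real_ivl split: if_splits)
      then have "K * \<bar>r - s\<bar> \<le> K * \<bar>t - s\<bar>"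
        using K(1) by simp
      then show ?thesis
        using lip[of s r] sub that st by force
    qed
    then have "\<bar>?g t - ?g s\<bar> \<le> K * \<bar>t - s\<bar> * \<bar>t - s\<bar>"
      using field_differentiable_bound[of ?S ?g "\<lambda>r. f' r - f' s" "K * \<bar>t - s\<bar>" t s] deriv by auto
    then show ?thesis
      by (simp add: power2_eq_square mult.assoc flip: abs_mult)
  qed
  then show ?thesis
    using that[of K f'] K(1) f' lip by auto
qed

text \<open>\<open>Lim\<close> yields a known value only once convergence is established. Since
  \<open>s < b\<close>, the derivative within \<open>{s..b}\<close> is exactly such a right-hand
  limit.\<close>

lemma dt_plus_eq:
  assumes "(u x has_real_derivative D) (at s within {s..b})" "s < b"
  shows "dt_plus u x s = D"
proof -
  have "((\<lambda>y. (u x y - u x s) / (y - s)) \<longlongrightarrow> D) (at_right s)"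
    using assms by (simp add: has_field_derivative_iff at_within_Icc_at_right)
  then have "((\<lambda>h. (u x (s + h) - u x s) / h) \<longlongrightarrow> D) (at_right 0)"
    unfolding filterlim_at_right_to_0[of _ _ s] by (simp add: add.commute)
  then show ?thesis
    unfolding dt_plus_def by (intro tendsto_Lim) auto
qed

lemma dt_minus_eq:
  assumes "(u x has_real_derivative D) (at s within {a..s})" "a < s"
  shows "dt_minus u x s = D"
proof -
  have "((\<lambda>y. (u x y - u x s) / (y - s)) \<longlongrightarrow> D) (at_left s)"
    using assms by (simp add: has_field_derivative_iff at_within_Icc_at_left)
  then have "((\<lambda>h. (u x (s + h) - u x s) / h) \<longlongrightarrow> D) (at_left 0)"
    using filtermap_at_left_shift[of s s, symmetric]
    by (simp add: filterlim_filtermap)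
  then show ?thesis
    unfolding dt_minus_def by (intro tendsto_Lim) auto
qed

text \<open>The slope of \<open>f\<close> turns from \<open>d1\<close> to \<open>d2\<close> at
  \<open>g\<close>, while the Euler step keeps a slope \<open>d\<close> near \<open>d1\<close> up to
  \<open>t\<close>. The jump therefore acts only for the time \<open>t - g\<close>, which is
  estimated by the whole step. \<open>K1\<close> enters twice: for the left Taylor remainder and for
  replacing \<open>d\<close> by \<open>d1\<close>.\<close>

lemma kink_step_error:
  fixes f :: "real \<Rightarrow> real"
  assumes "s \<le> g" "g \<le> t" "K1 \<ge> 0" "K2 \<ge> 0"
    and "\<bar>f s - f g - (s - g) * d1\<bar> \<le> K1 * (s - g)\<^sup>2"
    and "\<bar>d - d1\<bar> \<le> K1 * \<bar>s - g\<bar>"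
    and "\<bar>f t - f g - (t - g) * d2\<bar> \<le> K2 * (t - g)\<^sup>2"
  shows "\<bar>f s + (t - s) * d - f t\<bar> \<le> (t - s) * \<bar>d2 - d1\<bar> + (2 * K1 + K2) * (t - s)\<^sup>2"
proof -
  have sg: "(s - g)\<^sup>2 \<le> (t - s)\<^sup>2" and tg: "(t - g)\<^sup>2 \<le> (t - s)\<^sup>2"
    using assms(1,2) by (auto intro!: power2_le_iff_abs_le[THEN iffD2])
  have "K1 * (s - g)\<^sup>2 \<le> K1 * (t - s)\<^sup>2" "K2 * (t - g)\<^sup>2 \<le> K2 * (t - s)\<^sup>2"
    using sg tg assms(3,4) by (auto intro: mult_left_mono)
  moreover have "\<bar>(t - s) * (d - d1)\<bar> \<le> K1 * (t - s)\<^sup>2"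
  proof -
    have "K1 * \<bar>s - g\<bar> \<le> K1 * (t - s)"
      using assms(1-3) by (intro mult_left_mono) auto
    then have "(t - s) * \<bar>d - d1\<bar> \<le> (t - s) * (K1 * (t - s))"
      using assms(1,2,6) by (intro mult_left_mono) auto
    then show ?thesis
      using assms(1,2) by (simp add: abs_mult power2_eq_square mult_ac)
  qed
  moreover have "\<bar>(t - g) * (d2 - d1)\<bar> \<le> (t - s) * \<bar>d2 - d1\<bar>"
    using assms(1,2) by (auto simp: abs_mult intro: mult_right_mono)
  moreover have "f s + (t - s) * d - f t = (f s - f g - (s - g) * d1) + (t - s) * (d - d1)
      - (f t - f g - (t - g) * d2) - (t - g) * (d2 - d1)"
    by (simp add: algebra_simps)
  moreover have "(2 * K1 + K2) * (t - s)\<^sup>2 = K1 * (t - s)\<^sup>2 + K1 * (t - s)\<^sup>2 + K2 * (t - s)\<^sup>2"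
    by (simp add: algebra_simps)
  ultimately show ?thesis
    using assms(5,7) by linarith
qed

text \<open>Here \<open>D\<close> is the jump, \<open>a\<close> the error of a step from the exact
  value, \<open>b\<close> the error of \<open>Uhat\<close>, and \<open>X\<close>, \<open>Y\<close>
  stand for \<open>\<Delta>x powr p\<close>, \<open>\<Delta>x powr q\<close>. By
  \<open>\<Delta>t \<le> 1\<close> and \<open>Y \<le> 1\<close>, the bound on \<open>a\<close> is at
  most a constant times \<open>\<Delta>t\<close>, so a nonzero \<open>D\<close> can be divided out.
  If \<open>D = 0\<close>, the quotient by zero is \<open>0\<close> and the second condition on
  \<open>C\<close> is just \<open>C \<ge> 0\<close>.\<close>

lemma absorb_into_jump:
  fixes D L K a b \<Delta>t X Y :: real
  assumes "L \<ge> 0" "K \<ge> 0" "0 < \<Delta>t" "\<Delta>t \<le> 1" "0 \<le> X" "0 \<le> Y" "Y \<le> 1"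
    and a: "\<bar>a\<bar> \<le> \<Delta>t * \<bar>D\<bar> + L * \<Delta>t\<^sup>2 + K * (\<Delta>t * Y)"
    and b: "\<bar>b\<bar> \<le> K * X"
    and C: "C \<ge> L + K" "C \<ge> (\<bar>D\<bar> + L + K) / \<bar>D\<bar>"
  shows "\<exists>R1 R2. \<bar>a + b\<bar> = D * R1 + R2 \<and> \<bar>R1\<bar> \<le> C * \<Delta>t \<and>
      \<bar>R2\<bar> \<le> C * (X + (if D \<noteq> 0 then 0 else \<Delta>t\<^sup>2 + \<Delta>t * Y))"
proof -
  have C0: "C \<ge> 0" "C \<ge> K" "C \<ge> L"
    using C(1) assms(1,2) by auto
  have bC: "\<bar>b\<bar> \<le> C * X"
    using b mult_right_mono[OF C0(2) assms(5)] by linarith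
  show ?thesis
  proof (cases "D = 0")
    case True
    have "L * \<Delta>t\<^sup>2 \<le> C * \<Delta>t\<^sup>2" "K * (\<Delta>t * Y) \<le> C * (\<Delta>t * Y)"
      using C0 assms(3,6) by (auto intro!: mult_right_mono)
    then have "\<bar>a + b\<bar> \<le> C * (X + (\<Delta>t\<^sup>2 + \<Delta>t * Y))"
      using a bC True by (simp add: distrib_left)
    then show ?thesis
      using True C0 assms(3) by (intro exI[of _ 0] exI[of _ "\<bar>a + b\<bar>"]) simp
  next
    case False
    have "L * \<Delta>t\<^sup>2 \<le> L * \<Delta>t"
      using assms(1,3,4) by (intro mult_left_mono) (auto simp: power2_eq_square mult_left_le)
    moreover have "K * (\<Delta>t * Y) \<le> K * \<Delta>t"
      using assms(2,3,7) by (intro mult_left_mono) (auto simp: mult_left_le)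
    ultimately have "\<bar>a\<bar> \<le> (\<bar>D\<bar> + L + K) * \<Delta>t"
      using a by (simp add: algebra_simps)
    then have "\<bar>a\<bar> / \<bar>D\<bar> \<le> (\<bar>D\<bar> + L + K) / \<bar>D\<bar> * \<Delta>t"
      using False by (simp add: divide_right_mono)
    also have "\<dots> \<le> C * \<Delta>t"
      using C(2) assms(3) by (intro mult_right_mono) auto
    finally have "\<bar>\<bar>a\<bar> / D\<bar> \<le> C * \<Delta>t"
      by simp
    moreover have "\<bar>\<bar>a + b\<bar> - \<bar>a\<bar>\<bar> \<le> C * X"
      using bC by linarith
    \<comment> \<open>Dividing by \<open>D\<close> rather than by its absolute value gives
      \<open>D * R1 = \<bar>a\<bar>\<close> for either sign of the jump; what remains is at most
      \<open>\<bar>b\<bar>\<close> in size.\<close>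
    ultimately show ?thesis
      using False by (intro exI[of _ "\<bar>a\<bar> / D"] exI[of _ "\<bar>a + b\<bar> - \<bar>a\<bar>"]) simp
  qed
qed

theorem proposition2p1:
  fixes xmin xmax T \<epsilon> :: real
    and \<gamma> \<gamma>l \<gamma>r :: "real \<Rightarrow> real"
    and u :: "real \<Rightarrow> real \<Rightarrow> real"
    and P h :: nat
    and A1 A2 :: "(nat \<Rightarrow> nat) set"
    and c1 c2 :: "(nat \<Rightarrow> nat) \<Rightarrow> real"
    and w :: "real \<Rightarrow> real \<Rightarrow> int \<Rightarrow> real"
    and Fhat :: "real \<Rightarrow> real \<Rightarrow> (int \<Rightarrow> real) \<Rightarrow> real"
    and p q x :: real
  defines "\<Omega>1 \<equiv> Omega1 xmin xmax T \<gamma>"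
    and "\<Omega>2 \<equiv> Omega2 xmin xmax T \<gamma>"
  defines "F1 \<equiv> pde_rhs P A1 c1 \<Omega>1 u"
    and "F2 \<equiv> pde_rhs P A2 c2 \<Omega>2 u"
  assumes "xmin < xmax" and "T > 0" and "\<epsilon> > 0"
    and "continuous_on {xmin..xmax} \<gamma>"
    and "\<And>y. y \<in> {xmin..xmax} \<Longrightarrow> \<epsilon> < \<gamma> y \<and> \<gamma> y < T - \<epsilon>"
    and "continuous_on (Omega xmin xmax T) (\<lambda>(y, t). u y t)"
    and "spatially_differentiable P \<Omega>1 u" and "spatially_differentiable P \<Omega>2 u"
    and "finite A1" and "finite A2"
    and "satisfies_pde T \<Omega>1 u F1" and "satisfies_pde T \<Omega>2 u F2"
    and "\<And>y. y \<in> {xmin..xmax} \<Longrightarrow> C2_on (u y) {0..\<gamma> y} \<and> C2_on (u y) {\<gamma> y..T}"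
    and "\<And>y. y \<in> {xmin..xmax} \<Longrightarrow> 0 < \<gamma>l y \<and> \<gamma>l y < \<gamma>r y \<and> \<gamma>r y < T"
    and "h \<ge> 1" and "p > 1" and "q > 1"
    and "x \<in> {xmin..xmax}"
    and "consistent xmin xmax \<Omega>1 u F1 \<gamma>l \<gamma>r h w Fhat p q x"
  shows "\<exists>C>0. \<exists>\<delta>0>0. \<forall>\<Delta>t \<Delta>x m.
      0 < \<Delta>t \<longrightarrow> \<Delta>t < \<delta>0 \<longrightarrow> 0 < \<Delta>x \<longrightarrow> \<Delta>x < \<delta>0 \<longrightarrow> grid_index \<gamma>l \<gamma>r x \<Delta>t (Suc m) \<longrightarrow>
      stencil_within xmin xmax h \<Delta>x x (tau \<gamma>l x \<Delta>t m) \<Omega>1 \<longrightarrow>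
      tau \<gamma>l x \<Delta>t m < \<gamma> x \<longrightarrow> \<gamma> x < tau \<gamma>l x \<Delta>t (Suc m) \<longrightarrow>
      (\<exists>R1 R2.
         evolution_error xmin xmax u \<gamma>l h (w \<Delta>t \<Delta>x) (Fhat \<Delta>t \<Delta>x) \<Delta>t \<Delta>x m x
           = (dt_plus u x (\<gamma> x) - dt_minus u x (\<gamma> x)) * R1 + R2 \<and>
         \<bar>R1\<bar> \<le> C * \<Delta>t \<and>
         \<bar>R2\<bar> \<le> C * (\<Delta>x powr p + (if dt_plus u x (\<gamma> x) \<noteq> dt_minus u x (\<gamma> x) then 0
                            else \<Delta>t ^ 2 + \<Delta>t * \<Delta>x powr q)))"
proof -
  define g where "g = \<gamma> x"
  have x: "x \<in> {xmin..xmax}"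
    using assms by blast
  have g: "0 < g" "g < T"
    using assms(9)[OF x] assms(7) unfolding g_def by auto
  have \<gamma>r: "\<gamma>r x < T"
    using assms(18)[OF x] by auto
  have C2: "C2_on (u x) {0..g}" "C2_on (u x) {g..T}"
    using assms(17)[OF x] unfolding g_def by auto
  obtain f1 K1 where K1: "K1 \<ge> 0"
    and f1: "\<And>t. t \<in> {0..g} \<Longrightarrow> (u x has_real_derivative f1 t) (at t within {0..g})"
    and lip1: "\<And>s t. s \<in> {0..g} \<Longrightarrow> t \<in> {0..g} \<Longrightarrow> \<bar>f1 t - f1 s\<bar> \<le> K1 * \<bar>t - s\<bar>"
    and Taylor1: "\<And>s t. s \<in> {0..g} \<Longrightarrow> t \<in> {0..g} \<Longrightarrow>
        \<bar>u x t - u x s - (t - s) * f1 s\<bar> \<le> K1 * (t - s)\<^sup>2"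
    by (rule C2_on_Taylor_bound[OF C2(1)]) (rule that)
  obtain f2 K2 where K2: "K2 \<ge> 0"
    and f2: "\<And>t. t \<in> {g..T} \<Longrightarrow> (u x has_real_derivative f2 t) (at t within {g..T})"
    and Taylor2: "\<And>s t. s \<in> {g..T} \<Longrightarrow> t \<in> {g..T} \<Longrightarrow>
        \<bar>u x t - u x s - (t - s) * f2 s\<bar> \<le> K2 * (t - s)\<^sup>2"
    by (rule C2_on_Taylor_bound[OF C2(2)]) (rule that)
  have plus: "dt_plus u x g = f2 g"
    using f2 g by (intro dt_plus_eq[where b = T]) auto
  have minus: "dt_minus u x g = f1 g"
    using f1 g by (intro dt_minus_eq[where a = 0]) auto
  \<comment> \<open>Consistency speaks of \<open>F1\<close>, the Taylor bounds of the witness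
    \<open>f1\<close>. Both are time derivatives of \<open>u x\<close> within \<open>{0..g}\<close>,
    where no point is isolated, so they agree.\<close>
  have F1: "F1 x t = f1 t" if "(x, t) \<in> \<Omega>1" for t
  proof -
    have t: "0 \<le> t" "t < g"
      using that unfolding \<Omega>1_def Omega1_def Omega_def g_def by auto
    have "(u x has_real_derivative F1 x t) (at t within {0..T})"
      using assms(15) that unfolding satisfies_pde_def by auto
    then have "(u x has_real_derivative F1 x t) (at t within {0..g})"
      using g by (auto intro: DERIV_subset)
    moreover have "(u x has_real_derivative f1 t) (at t within {0..g})"
      using f1 t by auto
    moreover have "at t within {0..g} \<noteq> bot"
      using t by (simp add: trivial_limit_within islimpt_Icc)
    ultimately show ?thesis
      by (rule has_field_derivative_unique)
  qed
  define D where "D = f2 g - f1 g"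
  define L where "L = 2 * K1 + K2"
  obtain K \<delta> where K: "K > 0" and \<delta>: "\<delta> > 0"
    and cons: "\<And>\<Delta>t \<Delta>x m. 0 < \<Delta>t \<Longrightarrow> \<Delta>t < \<delta> \<Longrightarrow> 0 < \<Delta>x \<Longrightarrow> \<Delta>x < \<delta> \<Longrightarrow>
        grid_index \<gamma>l \<gamma>r x \<Delta>t m \<Longrightarrow> (x, tau \<gamma>l x \<Delta>t m) \<in> \<Omega>1 \<Longrightarrow>
        stencil_within xmin xmax h \<Delta>x x (tau \<gamma>l x \<Delta>t m) \<Omega>1 \<Longrightarrow>
          \<bar>u x (tau \<gamma>l x \<Delta>t m)
            - Uhat h (w \<Delta>t \<Delta>x) (stencil xmin xmax u h \<Delta>x x (tau \<gamma>l x \<Delta>t m))\<bar> \<le> K * \<Delta>x powr p \<and>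
          \<bar>F1 x (tau \<gamma>l x \<Delta>t m)
            - Fhat \<Delta>t \<Delta>x (stencil xmin xmax u h \<Delta>x x (tau \<gamma>l x \<Delta>t m))\<bar> \<le> K * \<Delta>x powr q"
    using assms(23) unfolding consistent_def by blast
  \<comment> \<open>The sum of the two lower bounds demanded by \<open>absorb_into_jump\<close>.
    Both are nonnegative, also for \<open>D = 0\<close>, and \<open>K > 0\<close> makes
    \<open>C\<close> positive.\<close>
  define C where "C = L + K + (\<bar>D\<bar> + L + K) / \<bar>D\<bar>"
  have L: "L \<ge> 0"
    using K1 K2 unfolding L_def by auto
  have ratio: "(\<bar>D\<bar> + L + K) / \<bar>D\<bar> \<ge> 0"
    using L K by auto
  \<comment> \<open>The \<open>1\<close> in \<open>min \<delta> 1\<close> provides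
    \<open>\<Delta>t \<le> 1\<close> and \<open>\<Delta>x powr q \<le> 1\<close> for the
    absorption.\<close>
  have "\<exists>R1 R2.
      evolution_error xmin xmax u \<gamma>l h (w \<Delta>t \<Delta>x) (Fhat \<Delta>t \<Delta>x) \<Delta>t \<Delta>x m x = D * R1 + R2 \<and>
      \<bar>R1\<bar> \<le> C * \<Delta>t \<and>
      \<bar>R2\<bar> \<le> C * (\<Delta>x powr p + (if D \<noteq> 0 then 0 else \<Delta>t\<^sup>2 + \<Delta>t * \<Delta>x powr q))"
    if \<Delta>t: "0 < \<Delta>t" "\<Delta>t < min \<delta> 1" and \<Delta>x: "0 < \<Delta>x" "\<Delta>x < min \<delta> 1"
      and grid: "grid_index \<gamma>l \<gamma>r x \<Delta>t (Suc m)"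
      and within: "stencil_within xmin xmax h \<Delta>x x (tau \<gamma>l x \<Delta>t m) \<Omega>1"
      and cross: "tau \<gamma>l x \<Delta>t m < g" "g < tau \<gamma>l x \<Delta>t (Suc m)" for \<Delta>t \<Delta>x m
  proof -
    define s where "s = tau \<gamma>l x \<Delta>t m"
    define t where "t = tau \<gamma>l x \<Delta>t (Suc m)"
    define U where "U = Uhat h (w \<Delta>t \<Delta>x) (stencil xmin xmax u h \<Delta>x x s)"
    define F where "F = Fhat \<Delta>t \<Delta>x (stencil xmin xmax u h \<Delta>x x s)"
    have ts: "t - s = \<Delta>t"
      unfolding s_def t_def tau_def by (simp add: algebra_simps)
    \<comment> \<open>The central stencil point is \<open>x\<close> itself, as \<open>wrap\<close>
      fixes the interval. Besides the premise of consistency this gives \<open>0 \<le> s\<close>,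
      which is not automatic: for \<open>m = 0\<close> the time lies one step before
      \<open>\<gamma>l x\<close>.\<close>
    have "(stencil_point xmin xmax x \<Delta>x 0, s) \<in> \<Omega>1"
      using within unfolding stencil_within_def s_def by (rule bspec) simp
    then have xs: "(x, s) \<in> \<Omega>1"
      using x by (simp add: stencil_point_def wrap_def)
    then have s: "s \<in> {0..g}"
      unfolding \<Omega>1_def Omega1_def Omega_def g_def by auto
    obtain M where M: "real M = (\<gamma>r x - \<gamma>l x) / \<Delta>t" "Suc m \<le> M"
      using grid unfolding grid_index_def by blast
    \<comment> \<open>Because \<open>tau\<close> starts at index \<open>0\<close> one step early,
      \<open>t\<close> equals \<open>\<gamma>l x + real m * \<Delta>t\<close>. Hence
      \<open>t\<close> stays below \<open>T\<close>, where the second Taylor bound is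
      available.\<close>
    have "real m * \<Delta>t \<le> real M * \<Delta>t"
      using M(2) \<Delta>t(1) by (intro mult_right_mono) auto
    also have "\<dots> = \<gamma>r x - \<gamma>l x"
      using M(1) \<Delta>t(1) by simp
    finally have "t \<le> \<gamma>r x"
      unfolding t_def tau_def by simp
    then have t: "t \<in> {g..T}"
      using \<gamma>r cross(2) unfolding t_def by auto
    have "grid_index \<gamma>l \<gamma>r x \<Delta>t m"
      using M unfolding grid_index_def by (intro exI[of _ M]) auto
    then have UF: "\<bar>u x s - U\<bar> \<le> K * \<Delta>x powr p" "\<bar>f1 s - F\<bar> \<le> K * \<Delta>x powr q"
      using cons[of \<Delta>t \<Delta>x m] \<Delta>t \<Delta>x within xs F1[OF xs] unfolding U_def F_def s_def by auto
    have "\<bar>u x s + \<Delta>t * f1 s - u x t\<bar> \<le> \<Delta>t * \<bar>D\<bar> + L * \<Delta>t\<^sup>2"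
      unfolding D_def L_def ts[symmetric]
      using s t g K1 K2 Taylor1[of g s] lip1[of g s] Taylor2[of g t]
      by (intro kink_step_error[where g = g]) auto
    moreover have "\<bar>\<Delta>t * (F - f1 s)\<bar> \<le> K * (\<Delta>t * \<Delta>x powr q)"
    proof -
      have "\<Delta>t * \<bar>F - f1 s\<bar> \<le> \<Delta>t * (K * \<Delta>x powr q)"
        using UF(2) \<Delta>t(1) by (intro mult_left_mono) (auto simp: abs_minus_commute)
      then show ?thesis
        using \<Delta>t(1) by (simp add: abs_mult mult_ac)
    qed
    moreover have "u x s + \<Delta>t * F - u x t = (u x s + \<Delta>t * f1 s - u x t) + \<Delta>t * (F - f1 s)"
      by (simp add: algebra_simps)
    ultimately have a: "\<bar>u x s + \<Delta>t * F - u x t\<bar> \<le> \<Delta>t * \<bar>D\<bar> + L * \<Delta>t\<^sup>2 + K * (\<Delta>t * \<Delta>x powr q)"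
      by linarith
    have b: "\<bar>U - u x s\<bar> \<le> K * \<Delta>x powr p"
      using UF(1) by (simp add: abs_minus_commute)
    have "evolution_error xmin xmax u \<gamma>l h (w \<Delta>t \<Delta>x) (Fhat \<Delta>t \<Delta>x) \<Delta>t \<Delta>x m x
        = \<bar>(u x s + \<Delta>t * F - u x t) + (U - u x s)\<bar>"
      unfolding evolution_error_def one_step_def s_def t_def U_def F_def by simp
    moreover have "\<Delta>x powr q \<le> 1"
      using \<Delta>x \<open>q > 1\<close> by (intro powr_le1) auto
    moreover have "C \<ge> L + K" "C \<ge> (\<bar>D\<bar> + L + K) / \<bar>D\<bar>"
      using ratio K L unfolding C_def by auto
    ultimately show ?thesis
      using absorb_into_jump[OF L _ _ _ _ _ _ a b, of C] K \<Delta>t by simp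
  qed
  moreover have "C > 0"
    using L K ratio unfolding C_def by linarith
  moreover have "min \<delta> 1 > 0"
    using \<delta> by simp
  \<comment> \<open>Rewriting with \<open>right_minus_eq\<close> turns the test whether the
    one-sided derivatives differ into \<open>D \<noteq> 0\<close>.\<close>
  ultimately show ?thesis
    unfolding g_def[symmetric] plus minus D_def[symmetric] right_minus_eq[symmetric, of "f2 g"] by blast
qed

end
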